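(* Suppose that the distribution of $Z$ is not circularly symmetric, i.e., that the hypothesis $H_0$ that $Z$ and $\mathrm{e}^{\mathrm{i}\vartheta}Z$ have the same distribution for each $\vartheta\in\Theta$ does not hold. Then \[ \sqrt n\left(\frac{T_n}{n}-\Delta\right)\ \text{converges in distribution to}\ \mathrm{N}(0,\sigma^2)\quad\text{as } n\to\infty, \] where \[ \sigma^2=4\int_{\Theta\times\mathbb{R}^{2d}}\int_{\Theta\times\mathbb{R}^{2d}}\widetilde K(s,\vartheta;t,\eta)\,v(s,\vartheta)\,v(t,\eta)\,w(\|s\|)\,w(\|t\|)\,\mathrm{d}s\,\mathrm{d}t\,\mathrm{d}\vartheta\,\mathrm{d}\eta, \] with $v(s,\vartheta):=\mathbb{E}[\ell(W,s,\vartheta)]$ and \[ \widetilde K(s,\vartheta;t,\eta):=\mathbb{E}\big[\ell(W,s,\vartheta)\,\ell(W,t,\eta)\big]-v(s,\vartheta)\,v(t,\eta),\qquad s,t\in\mathbb{R}^{2d},\ \vartheta,\eta\in\Theta . \]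
   Context: Let $d\ge 1$ be a fixed integer, $\Theta:=[-\pi,\pi)$, and let $Z,Z_1,Z_2,\ldots$ be independent and identically distributed $\mathbb{C}^d$-valued random vectors defined on a common probability space $(\Omega,\mathcal{A},\mathbb{P})$. For $z=(z_1,\ldots,z_d)^\top\in\mathbb{C}^d$ put $\mathrm{RI}(z):=(\mathrm{Re}\,z_1,\ldots,\mathrm{Re}\,z_d,\mathrm{Im}\,z_1,\ldots,\mathrm{Im}\,z_d)^\top\in\mathbb{R}^{2d}$. Set $W:=\mathrm{RI}(Z)$, $W_j:=\mathrm{RI}(Z_j)$, $W_\vartheta:=\mathrm{RI}(\mathrm{e}^{\mathrm{i}\vartheta}Z)=M_\vartheta W$ and $W_{\vartheta,j}:=\mathrm{RI}(\mathrm{e}^{\mathrm{i}\vartheta}Z_j)=M_\vartheta W_j$ for $\vartheta\in\Theta$, where \[ M_\vartheta=\begin{pmatrix}\cos\vartheta\,\mathrm{I}_d&-\sin\vartheta\,\mathrm{I}_d\\ \sin\vartheta\,\mathrm{I}_d&\cos\vartheta\,\mathrm{I}_d\end{pmatrix} \] and $\mathrm{I}_d$ is the unit matrix of order $d$. For an $\mathbb{R}^{2d}$-valued random vector $U$, $\varphi^\ast_U(t):=\mathbb{E}[\exp(\mathrm{i}t^\top U)]$, $t\in\mathbb{R}^{2d}$, denotes its characteristic function. The empirical characteristic functions are $\varphi_n^\ast(s):=\frac1n\sum_{j=1}^n\exp(\mathrm{i}s^\top W_j)$ and $\varphi_{n,\vartheta}^\ast(s):=\frac1n\sum_{j=1}^n\exp(\mathrm{i}s^\top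 W_{\vartheta,j})$, $s\in\mathbb{R}^{2d}$. Let $\|\cdot\|$ be the Euclidean norm on $\mathbb{R}^{2d}$, and let $w:[0,\infty)\to(0,\infty)$ be a measurable function (the weight function) such that $s\mapsto w(\|s\|)$ is (Lebesgue) integrable on $\mathbb{R}^{2d}$. The test statistic and its normalized limit are \[ T_n=n\int_\Theta\int_{\mathbb{R}^{2d}}\big|\varphi_n^\ast(s)-\varphi_{n,\vartheta}^\ast(s)\big|^2\,w(\|s\|)\,\mathrm{d}s\,\mathrm{d}\vartheta,\qquad \Delta=\int_\Theta\int_{\mathbb{R}^{2d}}\big|\varphi^\ast_{W}(s)-\varphi^\ast_{W_\vartheta}(s)\big|^2\,w(\|s\|)\,\mathrm{d}s\,\mathrm{d}\vartheta . \] Let $\mathrm{CS}^+(\xi):=\cos\xi+\sin\xi$, $\xi\in\mathbb{R}$, and \[ \ell(w,s,\vartheta):=\mathrm{CS}^+(s^\top w)-\mathrm{CS}^+(s^\top M_\vartheta w),\qquad w,s\in\mathbb{R}^{2d},\ \vartheta\in\Theta . \] $\mathrm{N}(0,\sigma^2)$ denotes the centred normal distribution with variance $\sigma^2$ (the point mass at $0$ if $\sigma^2=0$). *)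

theory Defs
  imports "HOL-Probability.Probability"
begin

definition Theta :: "real set" where
  "Theta = {-pi..<pi}"

text \<open>The coordinates of \<open>\<real>\<^sup>2\<^sup>d\<close> are indexed by the sum type \<open>'d + 'd\<close>: \<open>Inl k\<close> carries the
  \<open>k\<close>-th real part and \<open>Inr k\<close> the \<open>k\<close>-th imaginary part.\<close>

definition RI :: "complex ^ 'd \<Rightarrow> real ^ ('d::finite + 'd)" where
  "RI z = (\<chi> i. case i of Inl k \<Rightarrow> Re (z $ k) | Inr k \<Rightarrow> Im (z $ k))"

definition rotate :: "real \<Rightarrow> complex ^ 'd \<Rightarrow> complex ^ 'd" where
  "rotate \<theta> z = exp (\<i> * complex_of_real \<theta>) *s z"

definition rot_matrix :: "real \<Rightarrow> real ^ ('d::finite + 'd) ^ ('d + 'd)" where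
  "rot_matrix \<theta> = (\<chi> i j. case (i, j) of
       (Inl k, Inl l) \<Rightarrow> if k = l then cos \<theta> else 0
     | (Inl k, Inr l) \<Rightarrow> if k = l then - sin \<theta> else 0
     | (Inr k, Inl l) \<Rightarrow> if k = l then sin \<theta> else 0
     | (Inr k, Inr l) \<Rightarrow> if k = l then cos \<theta> else 0)"

lemma RI_rotate: "RI (rotate \<theta> z) = rot_matrix \<theta> *v RI (z :: complex ^ 'd::finite)"
proof -
  have sum_Plus': "(\<Sum>j\<in>UNIV. f j) = (\<Sum>l\<in>UNIV. f (Inl l)) + (\<Sum>l\<in>UNIV. f (Inr l))"
    for f :: "'d + 'd \<Rightarrow> real"
    by (subst UNIV_Plus_UNIV [symmetric], subst sum.Plus) (auto simp: o_def)
  show ?thesis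
    by (rule vec_eq_iff [THEN iffD2], intro allI)
      (auto simp: RI_def rotate_def rot_matrix_def matrix_vector_mult_def sum_Plus'
        if_distrib [of "\<lambda>x. x * _"] sum_negf Re_exp Im_exp split: sum.split cong: if_cong)
qed

definition iid :: "'a measure \<Rightarrow> ('i \<Rightarrow> 'a \<Rightarrow> 'b::topological_space) \<Rightarrow> 'i set \<Rightarrow> bool" where
  "iid M X I \<longleftrightarrow> prob_space.indep_vars M (\<lambda>_. borel) X I \<and>
     (\<forall>i\<in>I. \<forall>j\<in>I. distr M borel (X i) = distr M borel (X j))"

definition circularly_symmetric :: "'a measure \<Rightarrow> ('a \<Rightarrow> complex ^ 'd) \<Rightarrow> bool" where
  "circularly_symmetric M Z \<longleftrightarrow>
     (\<forall>\<theta>\<in>Theta. distr M borel (\<lambda>\<omega>. rotate \<theta> (Z \<omega>)) = distr M borel Z)"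

text \<open>The library function \<open>char\<close> covers distributions on the real line only.\<close>

definition char_fun :: "'a measure \<Rightarrow> ('a \<Rightarrow> 'b::euclidean_space) \<Rightarrow> 'b \<Rightarrow> complex" where
  "char_fun M U t = (LINT \<omega>|M. exp (\<i> * complex_of_real (t \<bullet> U \<omega>)))"

definition emp_char_fun ::
    "(nat \<Rightarrow> 'a \<Rightarrow> 'b::euclidean_space) \<Rightarrow> nat \<Rightarrow> 'a \<Rightarrow> 'b \<Rightarrow> complex" where
  "emp_char_fun U n \<omega> s =
     1 / of_nat n * (\<Sum>j=1..n. exp (\<i> * complex_of_real (s \<bullet> U j \<omega>)))"

definition test_stat ::
    "(real \<Rightarrow> real) \<Rightarrow> (nat \<Rightarrow> 'a \<Rightarrow> complex ^ 'd) \<Rightarrow> nat \<Rightarrow> 'a \<Rightarrow> real" where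
  "test_stat w Zs n \<omega> = real n *
     (LINT \<theta>:Theta|lborel. LINT s|lborel.
        (cmod (emp_char_fun (\<lambda>j \<omega>. RI (Zs j \<omega>)) n \<omega> s
             - emp_char_fun (\<lambda>j \<omega>. RI (rotate \<theta> (Zs j \<omega>))) n \<omega> s))\<^sup>2 * w (norm s))"

definition Delta :: "(real \<Rightarrow> real) \<Rightarrow> 'a measure \<Rightarrow> ('a \<Rightarrow> complex ^ 'd) \<Rightarrow> real" where
  "Delta w M Z =
     (LINT \<theta>:Theta|lborel. LINT s|lborel.
        (cmod (char_fun M (\<lambda>\<omega>. RI (Z \<omega>)) s
             - char_fun M (\<lambda>\<omega>. RI (rotate \<theta> (Z \<omega>))) s))\<^sup>2 * w (norm s))"

definition CS_plus :: "real \<Rightarrow> real" where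
  "CS_plus \<xi> = cos \<xi> + sin \<xi>"

definition ell :: "real ^ ('d::finite + 'd) \<Rightarrow> real ^ ('d::finite + 'd) \<Rightarrow> real \<Rightarrow> real" where
  "ell x s \<theta> = CS_plus (s \<bullet> x) - CS_plus (s \<bullet> (rot_matrix \<theta> *v x))"

definition v_fun :: "'a measure \<Rightarrow> ('a \<Rightarrow> complex ^ 'd) \<Rightarrow> real ^ ('d::finite + 'd) \<Rightarrow> real \<Rightarrow> real" where
  "v_fun M Z s \<theta> = (LINT \<omega>|M. ell (RI (Z \<omega>)) s \<theta>)"

definition K_tilde :: "'a measure \<Rightarrow> ('a \<Rightarrow> complex ^ 'd) \<Rightarrow>
    real ^ ('d::finite + 'd) \<Rightarrow> real \<Rightarrow> real ^ ('d::finite + 'd) \<Rightarrow> real \<Rightarrow> real" where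
  "K_tilde M Z s \<theta> t \<eta> =
     (LINT \<omega>|M. ell (RI (Z \<omega>)) s \<theta> * ell (RI (Z \<omega>)) t \<eta>) - v_fun M Z s \<theta> * v_fun M Z t \<eta>"

definition sigma_sq :: "(real \<Rightarrow> real) \<Rightarrow> 'a measure \<Rightarrow> ('a \<Rightarrow> complex ^ 'd) \<Rightarrow> real" where
  "sigma_sq w M Z = 4 *
     (LINT q:Theta \<times> UNIV|lborel. LINT p:Theta \<times> UNIV|lborel.
        (case (p, q) of ((\<theta>, s), (\<eta>, t)) \<Rightarrow>
           K_tilde M Z s \<theta> t \<eta> * v_fun M Z s \<theta> * v_fun M Z t \<eta> * w (norm s) * w (norm t)))"

text \<open>The argument is the variance, and is meant to be nonnegative.\<close>

definition centred_normal :: "real \<Rightarrow> real measure" where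
  "centred_normal \<sigma>2 =
     (if \<sigma>2 = 0 then return borel 0 else density lborel (normal_density 0 (sqrt \<sigma>2)))"

end

theory Submission imports Defs begin

text \<open>The cross term of \<open>(C + S)\<^sup>2\<close>, with \<open>C\<close> even and \<open>S\<close> odd in \<open>s\<close>, integrates to \<open>0\<close> against a
  radial weight. Hence \<open>T\<^sub>n / n\<close> and \<open>\<Delta>\<close> are the squared norms, in \<open>L\<^sup>2\<close> of the finite measure
  \<open>\<nu> = w(\<parallel>s\<parallel>) ds d\<theta>\<close> on \<open>\<Theta> \<times> \<real>\<^sup>2\<^sup>d\<close>, of the empirical mean of the bounded functions \<open>\<ell>(W\<^sub>j, \<cdot>)\<close>
  and of their expectation \<open>v\<close>. If \<open>G\<^sub>n\<close> is the difference of the two, then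
  \<open>\<parallel>v + G\<^sub>n\<parallel>\<^sup>2 - \<parallel>v\<parallel>\<^sup>2 = 2 \<langle>G\<^sub>n, v\<rangle> + \<parallel>G\<^sub>n\<parallel>\<^sup>2\<close>. The linear part is a mean of bounded i.i.d. centred
  variables with variance \<open>\<sigma>\<^sup>2\<close>, to which the central limit theorem applies, and the quadratic part
  is of order \<open>1 / n\<close> in \<open>L\<^sup>1\<close>, hence negligible after scaling by \<open>\<surd>n\<close>.\<close>

subsection \<open>Weak convergence and independence\<close>

lemma norm_iexp_add_diff_le:
  "cmod (iexp (t * (a + r)) - iexp (t * a)) \<le> \<bar>t\<bar> * \<bar>r\<bar>"
proof -
  have "iexp (t * (a + r)) - iexp (t * a) = iexp (t * a) * (iexp (t * r) - 1)"
    by (simp add: distrib_left exp_add right_diff_distrib)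
  then show ?thesis
    using iexp_approx1[of "t * r" 0] by (simp add: norm_mult abs_mult)
qed

text \<open>The map x -> exp(itx) is |t|-Lipschitz, so the characteristic functions of
  \<open>A n + R n\<close> and \<open>A n\<close> differ at t by at most |t| E|R_n|. This leaves the
  limit unchanged, and Levy's continuity theorem turns it back into weak convergence.\<close>

lemma (in prob_space) slutsky_L1:
  fixes A R :: "nat \<Rightarrow> 'a \<Rightarrow> real"
  assumes [measurable]: "\<And>n. random_variable borel (A n)"
    and R: "\<And>n. integrable M (R n)"
    and conv: "weak_conv_m (\<lambda>n. distr M borel (A n)) \<mu>" and \<mu>: "real_distribution \<mu>"
    and lim: "(\<lambda>n. expectation (\<lambda>\<omega>. \<bar>R n \<omega>\<bar>)) \<longlonglongrightarrow> 0"
  shows "weak_conv_m (\<lambda>n. distr M borel (\<lambda>\<omega>. A n \<omega> + R n \<omega>)) \<mu>"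
proof (rule levy_continuity)
  have [measurable]: "random_variable borel (R n)" for n
    using R by auto
  show "real_distribution (distr M borel (\<lambda>\<omega>. A n \<omega> + R n \<omega>))" for n
    by (intro real_distribution_distr) auto
  fix t :: real
  let ?a = "\<lambda>n. char (distr M borel (A n)) t"
  let ?b = "\<lambda>n. char (distr M borel (\<lambda>\<omega>. A n \<omega> + R n \<omega>)) t"
  have a: "?a \<longlonglongrightarrow> char \<mu> t"
    using conv \<mu> by (intro levy_continuity1 real_distribution_distr) auto
  have "norm (?b n - ?a n) \<le> \<bar>t\<bar> * expectation (\<lambda>\<omega>. \<bar>R n \<omega>\<bar>)" for n
  proof -
    have "?b n - ?a n = (CLINT \<omega>|M. iexp (t * (A n \<omega> + R n \<omega>)) - iexp (t * A n \<omega>))"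
      unfolding char_def
      by (subst Bochner_Integration.integral_diff)
         (auto simp: integral_distr intro!: integrable_iexp)
    also have "norm \<dots> \<le> expectation (\<lambda>\<omega>. \<bar>t\<bar> * \<bar>R n \<omega>\<bar>)"
      using R by (intro order_trans[OF integral_norm_bound integral_mono] integrable_norm
          Bochner_Integration.integrable_diff integrable_iexp norm_iexp_add_diff_le) auto
    finally show ?thesis by simp
  qed
  then have "(\<lambda>n. ?b n - ?a n) \<longlonglongrightarrow> 0"
    by (intro Lim_null_comparison[OF _ tendsto_mult_right_zero[OF lim, of "\<bar>t\<bar>"]] always_eventually allI)
  from tendsto_add[OF this a] show "?b \<longlonglongrightarrow> char \<mu> t"
    by simp
qed (rule \<mu>)

lemma real_distribution_centred_normal: "real_distribution (centred_normal v)" if "0 \<le> v"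
proof (cases "v = 0")
  case True
  then show ?thesis
    by (auto simp: centred_normal_def real_distribution_def real_distribution_axioms_def
        intro!: prob_space_return)
next
  case False
  with that show ?thesis
    by (auto simp: centred_normal_def real_distribution_def real_distribution_axioms_def
        intro!: prob_space_normal_density)
qed

text \<open>Rescaling expresses the characteristic function of the limit at t as the standard normal
  one at \<open>t * sqrt v\<close>.\<close>

lemma centred_normal_eq_distr:
  assumes "0 < v"
  shows "centred_normal v = distr std_normal_distribution borel (\<lambda>x. sqrt v * x)"
proof -
  interpret prob_space std_normal_distribution
    by (rule prob_space_normal_density) simp
  have "distributed std_normal_distribution lborel (\<lambda>x. x) std_normal_density"
    by (auto simp: distributed_def distr_id2 intro!: distr_id)
  from normal_density_affine[OF this, of "sqrt v" 0]
  have "distr std_normal_distribution lborel (\<lambda>x. sqrt v * x) = centred_normal v"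
    using assms by (auto simp: distributed_def centred_normal_def)
  moreover have "distr std_normal_distribution lborel (\<lambda>x. sqrt v * x)
      = distr std_normal_distribution borel (\<lambda>x. sqrt v * x)"
    by (rule distr_cong) auto
  ultimately show ?thesis by simp
qed

text \<open>Expanding the square gives a double sum whose off-diagonal terms factor by independence
  and vanish because the means are zero.\<close>

lemma (in prob_space) second_moment_sum_indep:
  fixes Y :: "'i \<Rightarrow> 'a \<Rightarrow> real"
  assumes indep: "indep_vars (\<lambda>_. borel) Y I" and I: "finite I"
    and mean: "\<And>i. i \<in> I \<Longrightarrow> expectation (Y i) = 0"
    and sq: "\<And>i. i \<in> I \<Longrightarrow> integrable M (\<lambda>\<omega>. (Y i \<omega>)\<^sup>2)"
  shows "integrable M (\<lambda>\<omega>. (\<Sum>i\<in>I. Y i \<omega>)\<^sup>2)"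
    and "expectation (\<lambda>\<omega>. (\<Sum>i\<in>I. Y i \<omega>)\<^sup>2) = (\<Sum>i\<in>I. expectation (\<lambda>\<omega>. (Y i \<omega>)\<^sup>2))"
proof -
  have rv: "random_variable borel (Y i)" if "i \<in> I" for i
    using indep that by (auto simp: indep_vars_def)
  have int: "integrable M (Y i)" if "i \<in> I" for i
    by (rule square_integrable_imp_integrable[OF rv sq]) (simp_all add: that)
  have pair: "integrable M (\<lambda>\<omega>. Y i \<omega> * Y j \<omega>) \<and>
      expectation (\<lambda>\<omega>. Y i \<omega> * Y j \<omega>) = (if i = j then expectation (\<lambda>\<omega>. (Y i \<omega>)\<^sup>2) else 0)"
    if ij: "i \<in> I" "j \<in> I" for i j
  proof (cases "i = j")
    case True
    then show ?thesis using sq ij by (simp add: power2_eq_square)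
  next
    case False
    \<comment> \<open>For distinct i and j the product over the set \<open>{i, j}\<close> is
      \<open>Y i * Y j\<close>, so the product rule for independent families applies to the
      pair.\<close>
    have "indep_vars (\<lambda>_. borel) Y {i, j}"
      using ij by (intro indep_vars_subset[OF indep]) auto
    then have "integrable M (\<lambda>\<omega>. \<Prod>k\<in>{i, j}. Y k \<omega>)"
      "expectation (\<lambda>\<omega>. \<Prod>k\<in>{i, j}. Y k \<omega>) = (\<Prod>k\<in>{i, j}. expectation (Y k))"
      using ij int by (intro indep_vars_integrable indep_vars_lebesgue_integral; auto)+
    then show ?thesis
      using False ij mean by simp
  qed
  have eq: "(\<Sum>i\<in>I. Y i \<omega>)\<^sup>2 = (\<Sum>i\<in>I. \<Sum>j\<in>I. Y i \<omega> * Y j \<omega>)" for \<omega>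
    by (simp add: power2_eq_square sum_product)
  show "integrable M (\<lambda>\<omega>. (\<Sum>i\<in>I. Y i \<omega>)\<^sup>2)"
    unfolding eq using pair by (intro Bochner_Integration.integrable_sum) auto
  have "expectation (\<lambda>\<omega>. (\<Sum>i\<in>I. Y i \<omega>)\<^sup>2) = (\<Sum>i\<in>I. \<Sum>j\<in>I. expectation (\<lambda>\<omega>. Y i \<omega> * Y j \<omega>))"
    unfolding eq by (simp add: pair[THEN conjunct1])
  also have "\<dots> = (\<Sum>i\<in>I. \<Sum>j\<in>I. if i = j then expectation (\<lambda>\<omega>. (Y i \<omega>)\<^sup>2) else 0)"
    using pair by (intro sum.cong refl) auto
  also have "\<dots> = (\<Sum>i\<in>I. expectation (\<lambda>\<omega>. (Y i \<omega>)\<^sup>2))"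
    using I by simp
  finally show "expectation (\<lambda>\<omega>. (\<Sum>i\<in>I. Y i \<omega>)\<^sup>2) = (\<Sum>i\<in>I. expectation (\<lambda>\<omega>. (Y i \<omega>)\<^sup>2))" .
qed

text \<open>Normalising by \<open>sqrt n\<close> rather than by the standard deviation of the sum
  makes room for the degenerate case v = 0, which has to be covered because the limit variance may
  vanish.\<close>

lemma (in prob_space) central_limit_theorem_centred_normal:
  fixes Y :: "nat \<Rightarrow> 'a \<Rightarrow> real"
  assumes indep: "indep_vars (\<lambda>_. borel) Y UNIV"
    and mean: "\<And>i. expectation (Y i) = 0"
    and sq: "\<And>i. integrable M (\<lambda>\<omega>. (Y i \<omega>)\<^sup>2)"
    and var: "\<And>i. expectation (\<lambda>\<omega>. (Y i \<omega>)\<^sup>2) = v"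
    and dist: "\<And>i. distr M borel (Y i) = \<mu>"
  shows "weak_conv_m (\<lambda>n. distr M borel (\<lambda>\<omega>. (\<Sum>i<n. Y i \<omega>) / sqrt n)) (centred_normal v)"
proof -
  have rv [measurable]: "random_variable borel (Y i)" for i
    using indep by (auto simp: indep_vars_def)
  have "0 \<le> expectation (\<lambda>\<omega>. (Y 0 \<omega>)\<^sup>2)" by simp
  then have v: "0 \<le> v" by (simp only: var)
  show ?thesis
  proof (rule levy_continuity)
    show "real_distribution (distr M borel (\<lambda>\<omega>. (\<Sum>i<n. Y i \<omega>) / sqrt n))" for n
      by (intro real_distribution_distr) auto
    show "real_distribution (centred_normal v)"
      using v by (rule real_distribution_centred_normal)
    fix t
    show "(\<lambda>n. char (distr M borel (\<lambda>\<omega>. (\<Sum>i<n. Y i \<omega>) / sqrt n)) t) \<longlonglongrightarrow> char (centred_normal v) t"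
    proof (cases "v = 0")
      case True
      \<comment> \<open>A zero second moment makes each \<open>Y i\<close> vanish almost surely, and
        countability makes this simultaneous in i. All characteristic functions are then constantly
        1, like that of the point mass at 0.\<close>
      have "AE \<omega> in M. Y i \<omega> = 0" for i
        using integral_nonneg_eq_0_iff_AE[OF sq[of i]] var[of i] True by simp
      then have ae: "AE \<omega> in M. \<forall>i. Y i \<omega> = 0"
        by (simp add: AE_all_countable)
      have "char (distr M borel (\<lambda>\<omega>. (\<Sum>i<n. Y i \<omega>) / sqrt n)) t = 1" for n
      proof -
        have "char (distr M borel (\<lambda>\<omega>. (\<Sum>i<n. Y i \<omega>) / sqrt n)) t
            = (CLINT \<omega>|M. iexp (t * ((\<Sum>i<n. Y i \<omega>) / sqrt n)))"
          by (simp add: char_def integral_distr)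
        also have "\<dots> = (CLINT \<omega>|M. 1)"
          using ae by (intro integral_cong_AE) auto
        finally show ?thesis by (simp add: prob_space)
      qed
      moreover have "char (centred_normal v) t = 1"
        using True by (simp add: centred_normal_def char_def integral_return)
      ultimately show ?thesis by simp
    next
      case False
      with v have v: "0 < v" by simp
      have "weak_conv_m (\<lambda>n. distr M borel (\<lambda>\<omega>. (\<Sum>i<n. Y i \<omega>) / sqrt (n * (sqrt v)\<^sup>2)))
          std_normal_distribution"
        using v var mean by (intro central_limit_theorem_zero_mean[OF indep mean _ sq _ dist]) auto
      then have *: "weak_conv_m (\<lambda>n. distr M borel (\<lambda>\<omega>. (\<Sum>i<n. Y i \<omega>) / sqrt (n * v)))
          std_normal_distribution"
        using v by simp
      \<comment> \<open>Evaluating at \<open>t * sqrt v\<close> cancels the factor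
        \<open>sqrt v\<close> in the denominator of the standardised sum.\<close>
      have "(\<lambda>n. char (distr M borel (\<lambda>\<omega>. (\<Sum>i<n. Y i \<omega>) / sqrt (n * v))) (t * sqrt v))
          \<longlonglongrightarrow> char std_normal_distribution (t * sqrt v)"
        by (intro levy_continuity1 * real_dist_normal_dist real_distribution_distr) auto
      moreover have "char (distr M borel (\<lambda>\<omega>. (\<Sum>i<n. Y i \<omega>) / sqrt (n * v))) (t * sqrt v)
          = char (distr M borel (\<lambda>\<omega>. (\<Sum>i<n. Y i \<omega>) / sqrt n)) t" for n
        using v by (simp add: char_def integral_distr real_sqrt_mult)
      moreover have "char std_normal_distribution (t * sqrt v) = char (centred_normal v) t"
        by (simp add: centred_normal_eq_distr[OF v] char_def integral_distr mult.assoc)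
      ultimately show ?thesis by simp
    qed
  qed
qed

text \<open>Injectivity keeps distinct indices distinct, so a product over J equals the product over
  its image. With \<open>Suc\<close> for g this passes from the family \<open>Zs(0 := Z)\<close> to
  the sample alone.\<close>

lemma (in prob_space) indep_vars_reindex_inj:
  assumes "indep_vars N X UNIV" "inj g"
  shows "indep_vars (\<lambda>i. N (g i)) (\<lambda>i. X (g i)) UNIV"
proof -
  have "indep_sets (\<lambda>i. {X (g i) -` A \<inter> space M | A. A \<in> sets (N (g i))}) UNIV"
  proof (rule indep_setsI)
    show "{X (g i) -` A \<inter> space M | A. A \<in> sets (N (g i))} \<subseteq> events" for i
      using assms(1) by (auto simp: indep_vars_def2 intro!: measurable_sets)
    fix A J
    assume J: "J \<noteq> {}" "finite J"
      and A: "\<forall>j\<in>J. A j \<in> {X (g j) -` A \<inter> space M | A. A \<in> sets (N (g j))}"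
    \<comment> \<open>Carries the event attached to j over to the index \<open>g j\<close>, where
      independence of the original family can be applied.\<close>
    define B where "B k = A (inv g k)" for k
    have B: "B (g j) = A j" for j
      using assms(2) by (simp add: B_def)
    have "prob (\<Inter>k\<in>g ` J. B k) = (\<Prod>k\<in>g ` J. prob (B k))"
    proof (rule indep_setsD)
      show "indep_sets (\<lambda>i. {X i -` A \<inter> space M | A. A \<in> sets (N i)}) UNIV"
        using assms(1) by (simp add: indep_vars_def2)
    qed (use J A in \<open>simp_all add: B\<close>)
    then show "prob (\<Inter>j\<in>J. A j) = (\<Prod>j\<in>J. prob (A j))"
      using assms(2) by (simp add: B prod.reindex inj_on_subset[OF assms(2)] o_def image_image)
  qed
  with assms(1) show ?thesis
    by (simp add: indep_vars_def2)
qed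

subsection \<open>The squared norm of a mean of bounded kernels\<close>

lemma abs_power2_le: "\<bar>a\<bar> \<le> b \<Longrightarrow> \<bar>a\<^sup>2\<bar> \<le> b\<^sup>2" for a b :: real
  by (metis abs_ge_zero power_abs power_mono)

lemma abs_mult_le: "\<bar>a\<bar> \<le> A \<Longrightarrow> \<bar>b\<bar> \<le> B \<Longrightarrow> \<bar>a * b\<bar> \<le> A * B" for a b A B :: real
  by (simp add: abs_mult mult_mono')

lemma (in finite_measure) integrable_bounded:
  fixes f :: "'a \<Rightarrow> real"
  assumes "f \<in> borel_measurable M" "\<And>x. \<bar>f x\<bar> \<le> B"
  shows "integrable M f"
  using assms by (intro integrable_const_bound[where B = B]) auto

text \<open>A non-integrable function has integral 0 by convention, and the bound is nonnegative, so
  that case is trivial.\<close>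

lemma (in finite_measure) abs_integral_le_bound:
  fixes f :: "'a \<Rightarrow> real"
  assumes "\<And>x. \<bar>f x\<bar> \<le> B"
  shows "\<bar>integral\<^sup>L M f\<bar> \<le> B * measure M (space M)"
proof (cases "integrable M f")
  case True
  then have "norm (integral\<^sup>L M f) \<le> (\<integral>x. B \<partial>M)"
    using assms by (intro order_trans[OF integral_norm_bound integral_mono]) auto
  then show ?thesis by (simp add: mult.commute)
next
  case False
  moreover have "0 \<le> B"
    using assms order_trans[OF abs_ge_zero] by blast
  ultimately show ?thesis by (simp add: not_integrable_integral_eq)
qed

text \<open>A bounded measurable function is integrable over the product of two finite measures,
  which is what Fubini's theorem asks for.\<close>

lemma Fubini_integral_bounded:
  fixes f :: "'a \<Rightarrow> 'b \<Rightarrow> real"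
  assumes "finite_measure M1" "finite_measure M2"
    and "case_prod f \<in> borel_measurable (M1 \<Otimes>\<^sub>M M2)" "\<And>x y. \<bar>f x y\<bar> \<le> B"
  shows "(\<integral>y. \<integral>x. f x y \<partial>M1 \<partial>M2) = (\<integral>x. \<integral>y. f x y \<partial>M2 \<partial>M1)"
proof -
  interpret M1: finite_measure M1 by fact
  interpret M2: finite_measure M2 by fact
  interpret P: finite_measure "M1 \<Otimes>\<^sub>M M2"
    using assms(1,2) by (intro finite_measure_pair_measure)
  interpret pair_sigma_finite M1 M2 ..
  show ?thesis
    using assms(3,4) by (intro Fubini_integral P.integrable_bounded) auto
qed

text \<open>Abstract setting: the functions \<open>f (X i \<omega>)\<close> are i.i.d. bounded
  random elements of the L^2 space of \<open>\<nu>\<close>. The measure \<open>D\<close> serves both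
  as the target measurable space and as the common law, whence \<open>distr M D (X i) = D\<close>.
  In the application \<open>D\<close> is the law of W, \<open>f\<close> is \<open>ell\<close> and
  \<open>C\<close> is 4.\<close>

locale bounded_kernel = prob_space M + D: prob_space D + nu: finite_measure \<nu>
  for M :: "'a measure" and D :: "'b measure" and \<nu> :: "'q measure" +
  fixes X :: "nat \<Rightarrow> 'a \<Rightarrow> 'b" and f :: "'b \<Rightarrow> 'q \<Rightarrow> real" and C :: real
  assumes indep: "indep_vars (\<lambda>_. D) X UNIV"
    and distr_X: "\<And>i. distr M D (X i) = D"
    and f [measurable]: "case_prod f \<in> borel_measurable (D \<Otimes>\<^sub>M \<nu>)"
    and f_bound: "\<And>x q. \<bar>f x q\<bar> \<le> C"
begin

definition v :: "'q \<Rightarrow> real" where "v q = (\<integral>x. f x q \<partial>D)"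

definition g :: "'b \<Rightarrow> 'q \<Rightarrow> real" where "g x q = f x q - v q"

text \<open>The derivative of \<open>\<parallel>\<cdot>\<parallel>\<^sup>2\<close> at \<open>v\<close>, applied to the centred kernel.\<close>

definition h :: "'b \<Rightarrow> real" where "h x = 2 * (\<integral>q. g x q * v q \<partial>\<nu>)"

text \<open>The covariance of the kernel at two parameters, the abstract counterpart of
  \<open>K_tilde\<close>.\<close>

definition K :: "'q \<Rightarrow> 'q \<Rightarrow> real" where "K p q = (\<integral>x. f x p * f x q \<partial>D) - v p * v q"

lemma X [measurable]: "X i \<in> M \<rightarrow>\<^sub>M D"
  using indep by (auto simp: indep_vars_def)

lemma v_measurable [measurable]: "v \<in> borel_measurable \<nu>"
  unfolding v_def by measurable

lemma g_measurable [measurable]: "case_prod g \<in> borel_measurable (D \<Otimes>\<^sub>M \<nu>)"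
  unfolding g_def by measurable

lemma h_measurable [measurable]: "h \<in> borel_measurable D"
  unfolding h_def by measurable

lemma C_nonneg: "0 \<le> C"
  using f_bound order_trans[OF abs_ge_zero] by blast

lemma v_bound: "\<bar>v q\<bar> \<le> C"
  using D.abs_integral_le_bound[of "\<lambda>x. f x q", OF f_bound] by (simp add: v_def D.prob_space)

lemma g_bound: "\<bar>g x q\<bar> \<le> 2 * C"
  using f_bound[of x q] v_bound[of q] unfolding g_def by linarith

lemma g_v_bound: "\<bar>g x q * v q\<bar> \<le> 2 * C * C"
  by (rule abs_mult_le[OF g_bound v_bound])

definition H :: real where "H = 2 * (2 * C * C * measure \<nu> (space \<nu>))"

lemma h_bound: "\<bar>h x\<bar> \<le> H"
  unfolding h_def H_def by (intro abs_mult_le nu.abs_integral_le_bound[OF g_v_bound]) simp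

lemma f_integrable: "q \<in> space \<nu> \<Longrightarrow> integrable D (\<lambda>x. f x q)"
  by (rule D.integrable_bounded[OF _ f_bound]) auto

lemma g_integrable: "q \<in> space \<nu> \<Longrightarrow> integrable D (\<lambda>x. g x q)"
  by (rule D.integrable_bounded[OF _ g_bound]) auto

lemma integral_g: "q \<in> space \<nu> \<Longrightarrow> (\<integral>x. g x q \<partial>D) = 0"
  by (simp add: g_def f_integrable D.prob_space flip: v_def)

text \<open>In the expanded product each of the two mixed terms contributes
  \<open>- v p * v q\<close>, and the last term gives one of them back.\<close>

lemma integral_g_mult:
  assumes "p \<in> space \<nu>" "q \<in> space \<nu>"
  shows "(\<integral>x. g x p * g x q \<partial>D) = K p q"
proof -
  have *: "g x p * g x q = f x p * f x q - v p * f x q - v q * f x p + v p * v q" for x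
    by (simp add: g_def algebra_simps)
  have "integrable D (\<lambda>x. f x p * f x q)"
    using assms by (intro D.integrable_bounded[OF _ abs_mult_le[OF f_bound f_bound]]) measurable
  then show ?thesis
    unfolding * using assms by (simp add: f_integrable D.prob_space K_def flip: v_def)
qed

text \<open>After Fubini the inner integral over x vanishes, since \<open>g\<close> is centred at
  each parameter.\<close>

lemma integral_h: "(\<integral>x. h x \<partial>D) = 0"
proof -
  have "(\<integral>x. \<integral>q. g x q * v q \<partial>\<nu> \<partial>D) = (\<integral>q. \<integral>x. g x q * v q \<partial>D \<partial>\<nu>)"
    by (intro Fubini_integral_bounded[symmetric, where B = "2 * C * C"] nu.finite_measure_axioms
        D.finite_measure_axioms g_v_bound) measurable
  also have "\<dots> = (\<integral>q. 0 \<partial>\<nu>)"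
    by (intro Bochner_Integration.integral_cong) (auto simp: integral_g)
  finally show ?thesis by (simp add: h_def)
qed

text \<open>One factor \<open>h\<close> is written as an integral over q and Fubini is applied; then
  the other factor becomes an integral over p and Fubini is applied again. The innermost integral
  over x is the covariance, and 4 collects the factor 2 of each \<open>h\<close>.\<close>

lemma integral_h_sq: "(\<integral>x. (h x)\<^sup>2 \<partial>D) = 4 * (\<integral>q. \<integral>p. K p q * v p * v q \<partial>\<nu> \<partial>\<nu>)"
proof -
  have "(\<integral>x. (h x)\<^sup>2 \<partial>D) = (\<integral>x. 2 * (\<integral>q. (g x q * v q) * h x \<partial>\<nu>) \<partial>D)"
    by (simp add: h_def power2_eq_square)
  also have "\<dots> = 2 * (\<integral>x. \<integral>q. (g x q * v q) * h x \<partial>\<nu> \<partial>D)"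
    by simp
  also have "(\<integral>x. \<integral>q. (g x q * v q) * h x \<partial>\<nu> \<partial>D) = (\<integral>q. \<integral>x. (g x q * v q) * h x \<partial>D \<partial>\<nu>)"
    by (intro Fubini_integral_bounded[symmetric, where B = "2 * C * C * H"] nu.finite_measure_axioms
        D.finite_measure_axioms abs_mult_le[OF g_v_bound h_bound]) measurable
  also have "\<dots> = (\<integral>q. 2 * (\<integral>p. K p q * v p * v q \<partial>\<nu>) \<partial>\<nu>)"
  proof (rule Bochner_Integration.integral_cong[OF refl])
    fix q assume q: "q \<in> space \<nu>"
    have "(\<integral>x. (g x q * v q) * h x \<partial>D) = (\<integral>x. 2 * (\<integral>p. (g x p * v p) * (g x q * v q) \<partial>\<nu>) \<partial>D)"
      by (intro Bochner_Integration.integral_cong refl, subst integral_mult_left_zero) (simp add: h_def)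
    also have "\<dots> = 2 * (\<integral>x. \<integral>p. (g x p * v p) * (g x q * v q) \<partial>\<nu> \<partial>D)"
      by simp
    also have "(\<integral>x. \<integral>p. (g x p * v p) * (g x q * v q) \<partial>\<nu> \<partial>D)
        = (\<integral>p. \<integral>x. (g x p * v p) * (g x q * v q) \<partial>D \<partial>\<nu>)"
      using q
      by (intro Fubini_integral_bounded[symmetric, where B = "(2 * C * C) * (2 * C * C)"]
          nu.finite_measure_axioms D.finite_measure_axioms abs_mult_le[OF g_v_bound g_v_bound]) measurable
    also have "\<dots> = (\<integral>p. K p q * v p * v q \<partial>\<nu>)"
    proof (rule Bochner_Integration.integral_cong[OF refl])
      fix p assume p: "p \<in> space \<nu>"
      have "(\<integral>x. (g x p * v p) * (g x q * v q) \<partial>D) = (\<integral>x. (g x p * g x q) * (v p * v q) \<partial>D)"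
        by (simp add: mult_ac)
      also have "\<dots> = K p q * v p * v q"
        using p q by (simp only: integral_mult_left_zero integral_g_mult mult.assoc[of "K p q"])
      finally show "(\<integral>x. (g x p * v p) * (g x q * v q) \<partial>D) = K p q * v p * v q" .
    qed
    finally show "(\<integral>x. (g x q * v q) * h x \<partial>D) = 2 * (\<integral>p. K p q * v p * v q \<partial>\<nu>)" .
  qed
  finally show ?thesis by simp
qed

text \<open>The expression is the second moment of \<open>h\<close>. This makes the normal limit a
  genuine distribution and also yields the nonnegativity of \<open>sigma_sq\<close>.\<close>

lemma variance_nonneg: "0 \<le> 4 * (\<integral>q. \<integral>p. K p q * v p * v q \<partial>\<nu> \<partial>\<nu>)"
  unfolding integral_h_sq[symmetric] by simp

lemma expectation_X: "\<phi> \<in> borel_measurable D \<Longrightarrow> expectation (\<lambda>\<omega>. \<phi> (X i \<omega>)) = (\<integral>x. \<phi> x \<partial>D)"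
  for \<phi> :: "'b \<Rightarrow> real"
  using integral_distr[OF X, of \<phi> i] by (simp add: distr_X)

lemma clt_linear_part:
  "weak_conv_m (\<lambda>n. distr M borel (\<lambda>\<omega>. (\<Sum>i<n. h (X i \<omega>)) / sqrt n))
     (centred_normal (4 * (\<integral>q. \<integral>p. K p q * v p * v q \<partial>\<nu> \<partial>\<nu>)))"
proof (rule central_limit_theorem_centred_normal)
  show "indep_vars (\<lambda>_. borel) (\<lambda>i \<omega>. h (X i \<omega>)) UNIV"
    using indep by (rule indep_vars_compose2) auto
  show "expectation (\<lambda>\<omega>. h (X i \<omega>)) = 0" for i
    by (simp add: expectation_X integral_h)
  show "expectation (\<lambda>\<omega>. (h (X i \<omega>))\<^sup>2) = 4 * (\<integral>q. \<integral>p. K p q * v p * v q \<partial>\<nu> \<partial>\<nu>)" for i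
    using expectation_X[of "\<lambda>x. (h x)\<^sup>2" i] by (simp add: integral_h_sq)
  show "integrable M (\<lambda>\<omega>. (h (X i \<omega>))\<^sup>2)" for i
    by (rule integrable_bounded[OF _ abs_power2_le[OF h_bound]]) simp
  show "distr M borel (\<lambda>\<omega>. h (X i \<omega>)) = distr D borel h" for i
    using distr_distr[of h D borel "X i" M] by (simp add: distr_X o_def)
qed

text \<open>An average of terms bounded by \<open>2 * C\<close>; for n = 0 the quotient is 0 by
  convention and the bound reduces to \<open>C_nonneg\<close>.\<close>

lemma centred_mean_bound: "\<bar>(\<Sum>i<n. g (X i \<omega>) q) / real n\<bar> \<le> 2 * C"
proof (cases "n = 0")
  case False
  have "\<bar>\<Sum>i<n. g (X i \<omega>) q\<bar> \<le> (\<Sum>i<n. 2 * C)"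
    by (intro order_trans[OF sum_abs sum_mono] g_bound)
  with False show ?thesis by (simp add: field_simps)
qed (simp add: C_nonneg)

lemma centred_mean_sq_bound: "\<bar>((\<Sum>i<n. g (X i \<omega>) q) / real n)\<^sup>2\<bar> \<le> (2 * C)\<^sup>2"
  by (rule abs_power2_le[OF centred_mean_bound])

text \<open>Variance of a mean of independent centred terms with common second moment
  \<open>K q q\<close>. It is the source of the 1/n decay of the quadratic remainder.\<close>

lemma expectation_centred_mean_sq:
  assumes q: "q \<in> space \<nu>"
  shows "expectation (\<lambda>\<omega>. ((\<Sum>i<n. g (X i \<omega>) q) / real n)\<^sup>2) = K q q / real n"
proof -
  have [measurable]: "(\<lambda>x. g x q) \<in> borel_measurable D"
    using q by measurable
  have "expectation (\<lambda>\<omega>. (\<Sum>i<n. g (X i \<omega>) q)\<^sup>2) = (\<Sum>i<n. expectation (\<lambda>\<omega>. (g (X i \<omega>) q)\<^sup>2))"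
  proof (rule second_moment_sum_indep(2))
    have "indep_vars (\<lambda>_. borel) (\<lambda>i \<omega>. g (X i \<omega>) q) UNIV"
      using indep by (rule indep_vars_compose2) auto
    then show "indep_vars (\<lambda>_. borel) (\<lambda>i \<omega>. g (X i \<omega>) q) {..<n}"
      by (rule indep_vars_subset) simp
    show "expectation (\<lambda>\<omega>. g (X i \<omega>) q) = 0" for i
      using expectation_X[of "\<lambda>x. g x q" i] q by (simp add: integral_g)
    show "integrable M (\<lambda>\<omega>. (g (X i \<omega>) q)\<^sup>2)" for i
      by (rule integrable_bounded[OF _ abs_power2_le[OF g_bound]]) simp
  qed simp
  also have "\<dots> = (\<Sum>i<n. K q q)"
    using expectation_X[of "\<lambda>x. (g x q)\<^sup>2"] q by (simp add: power2_eq_square integral_g_mult)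
  finally show ?thesis
    by (simp add: power_divide power2_eq_square)
qed

lemma weak_conv_sq_norm_mean:
  "weak_conv_m (\<lambda>n. distr M borel (\<lambda>\<omega>. sqrt n *
      ((\<integral>q. ((\<Sum>i<n. f (X i \<omega>) q) / n)\<^sup>2 \<partial>\<nu>) - (\<integral>q. (v q)\<^sup>2 \<partial>\<nu>))))
    (centred_normal (4 * (\<integral>q. \<integral>p. K p q * v p * v q \<partial>\<nu> \<partial>\<nu>)))"
proof -
  \<comment> \<open>\<open>A\<close> is the scaled linear part, \<open>G\<close> the centred mean
    and \<open>R\<close> the scaled quadratic remainder.\<close>
  define A where "A n \<omega> = (\<Sum>i<n. h (X i \<omega>)) / sqrt (real n)" for n \<omega>
  define G where "G n \<omega> q = (\<Sum>i<n. g (X i \<omega>) q) / real n" for n \<omega> q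
  define R where "R n \<omega> = sqrt (real n) * (\<integral>q. (G n \<omega> q)\<^sup>2 \<partial>\<nu>)" for n \<omega>
  have [measurable]: "case_prod (G n) \<in> borel_measurable (M \<Otimes>\<^sub>M \<nu>)" for n
    unfolding G_def by measurable
  have G_sq: "\<bar>(G n \<omega> q)\<^sup>2\<bar> \<le> (2 * C)\<^sup>2" for n \<omega> q
    unfolding G_def by (rule centred_mean_sq_bound)
  have G_v: "\<bar>G n \<omega> q * v q\<bar> \<le> 2 * C * C" for n \<omega> q
    unfolding G_def by (rule abs_mult_le[OF centred_mean_bound v_bound])
  have v_sq: "\<bar>(v q)\<^sup>2\<bar> \<le> C\<^sup>2" for q
    by (rule abs_power2_le[OF v_bound])
  \<comment> \<open>An exact identity. Taking \<open>\<omega>\<close> in the sample space puts the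
    observations into the space of \<open>D\<close>, so that the sections of \<open>g\<close> there
    are measurable. For n = 0 both sides vanish because \<open>sqrt 0 = 0\<close>.\<close>
  have decomp: "sqrt n * ((\<integral>q. ((\<Sum>i<n. f (X i \<omega>) q) / n)\<^sup>2 \<partial>\<nu>) - (\<integral>q. (v q)\<^sup>2 \<partial>\<nu>)) = A n \<omega> + R n \<omega>"
    if \<omega>: "\<omega> \<in> space M" for n \<omega>
  proof (cases "n = 0")
    case False
    have Xs: "X i \<omega> \<in> space D" for i
      using measurable_space[OF X \<omega>] .
    have gm: "integrable \<nu> (\<lambda>q. g (X i \<omega>) q * v q)" for i
      using Xs[of i] by (intro nu.integrable_bounded[OF _ g_v_bound]) measurable
    have Gm [measurable]: "G n \<omega> \<in> borel_measurable \<nu>"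
      using \<omega> by measurable
    have int: "integrable \<nu> (\<lambda>q. (G n \<omega> q)\<^sup>2)" "integrable \<nu> (\<lambda>q. (v q)\<^sup>2)" "integrable \<nu> (\<lambda>q. G n \<omega> q * v q)"
      using G_sq v_sq G_v by (auto intro!: nu.integrable_bounded)
    have "((\<Sum>i<n. f (X i \<omega>) q) / n)\<^sup>2 = (v q)\<^sup>2 + 2 * (G n \<omega> q * v q) + (G n \<omega> q)\<^sup>2" for q
    proof -
      have "(\<Sum>i<n. f (X i \<omega>) q) / n = G n \<omega> q + v q"
        using False by (simp add: G_def g_def sum_subtractf field_simps)
      then show ?thesis by (simp add: power2_sum)
    qed
    then have "(\<integral>q. ((\<Sum>i<n. f (X i \<omega>) q) / n)\<^sup>2 \<partial>\<nu>) - (\<integral>q. (v q)\<^sup>2 \<partial>\<nu>)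
        = 2 * (\<integral>q. G n \<omega> q * v q \<partial>\<nu>) + (\<integral>q. (G n \<omega> q)\<^sup>2 \<partial>\<nu>)"
      using int by simp
    \<comment> \<open>The factor 2 is part of \<open>h\<close>, so the linear term is a mean of the
      \<open>h (X i \<omega>)\<close>; multiplying by \<open>sqrt n\<close> turns division by n into
      division by \<open>sqrt n\<close>.\<close>
    also have "2 * (\<integral>q. G n \<omega> q * v q \<partial>\<nu>) = (\<Sum>i<n. h (X i \<omega>)) / n"
      using gm by (simp add: G_def h_def sum_distrib_right flip: sum_distrib_left)
    finally show ?thesis
      by (simp add: A_def R_def distrib_left divide_simps mult.commute)
  qed (simp add: A_def R_def)
  have [measurable]: "A n \<in> borel_measurable M" "R n \<in> borel_measurable M" for n
    unfolding A_def R_def by measurable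
  have R_int: "integrable M (R n)" for n
  proof (rule integrable_bounded)
    show "\<bar>R n \<omega>\<bar> \<le> sqrt n * ((2 * C)\<^sup>2 * measure \<nu> (space \<nu>))" for \<omega>
      unfolding R_def abs_mult using G_sq by (intro mult_mono nu.abs_integral_le_bound) auto
  qed simp
  define B where "B = (\<integral>q. K q q \<partial>\<nu>)"
  \<comment> \<open>As \<open>R\<close> is nonnegative, its L^1 norm is its expectation. Fubini
    reduces it to the pointwise variances \<open>K q q / n\<close>, and the scaling by
    \<open>sqrt n\<close> leaves order 1 / \<open>sqrt n\<close>.\<close>
  have ER: "expectation (\<lambda>\<omega>. \<bar>R n \<omega>\<bar>) = B / sqrt n" for n
  proof -
    have "expectation (\<lambda>\<omega>. \<bar>R n \<omega>\<bar>) = sqrt n * expectation (\<lambda>\<omega>. \<integral>q. (G n \<omega> q)\<^sup>2 \<partial>\<nu>)"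
      by (simp add: R_def abs_mult)
    also have "expectation (\<lambda>\<omega>. \<integral>q. (G n \<omega> q)\<^sup>2 \<partial>\<nu>) = (\<integral>q. expectation (\<lambda>\<omega>. (G n \<omega> q)\<^sup>2) \<partial>\<nu>)"
      by (rule Fubini_integral_bounded[symmetric, OF finite_measure_axioms nu.finite_measure_axioms _ G_sq])
         measurable
    also have "\<dots> = (\<integral>q. K q q / n \<partial>\<nu>)"
      by (intro Bochner_Integration.integral_cong refl)
         (simp add: G_def expectation_centred_mean_sq)
    also have "sqrt n * \<dots> = B / sqrt n"
      by (cases "n = 0") (simp_all add: B_def field_simps flip: real_sqrt_mult)
    finally show ?thesis .
  qed
  have "(\<lambda>n. expectation (\<lambda>\<omega>. \<bar>R n \<omega>\<bar>)) \<longlonglongrightarrow> 0"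
    unfolding ER by real_asymp
  moreover have "real_distribution (centred_normal (4 * (\<integral>q. \<integral>p. K p q * v p * v q \<partial>\<nu> \<partial>\<nu>)))"
    by (rule real_distribution_centred_normal[OF variance_nonneg])
  ultimately have "weak_conv_m (\<lambda>n. distr M borel (\<lambda>\<omega>. A n \<omega> + R n \<omega>))
      (centred_normal (4 * (\<integral>q. \<integral>p. K p q * v p * v q \<partial>\<nu> \<partial>\<nu>)))"
    using clt_linear_part R_int by (intro slutsky_L1) (auto simp: A_def[abs_def])
  moreover have "distr M borel (\<lambda>\<omega>. sqrt n * ((\<integral>q. ((\<Sum>i<n. f (X i \<omega>) q) / n)\<^sup>2 \<partial>\<nu>) - (\<integral>q. (v q)\<^sup>2 \<partial>\<nu>)))
      = distr M borel (\<lambda>\<omega>. A n \<omega> + R n \<omega>)" for n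
    by (intro distr_cong refl decomp)
  ultimately show ?thesis by simp
qed

end

subsection \<open>Even and odd parts under a radial weight\<close>

text \<open>Reflection is an affine map with factor -1, whose Jacobian has absolute value 1.\<close>

lemma integral_lborel_uminus:
  fixes \<phi> :: "'a::euclidean_space \<Rightarrow> real"
  assumes "\<phi> \<in> borel_measurable borel"
  shows "(\<integral>x. \<phi> (- x) \<partial>lborel) = (\<integral>x. \<phi> x \<partial>lborel)"
proof -
  have "lborel = distr lborel borel (uminus :: 'a \<Rightarrow> 'a)"
    using lborel_affine[of "-1" "0 :: 'a"] by (simp add: density_1)
  then have "(\<integral>x. \<phi> x \<partial>lborel) = (\<integral>x. \<phi> x \<partial>distr lborel borel uminus)"
    by simp
  with assms show ?thesis
    by (simp add: integral_distr)
qed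

text \<open>The cross term is odd, so its integral equals its own negative. This lets the squared
  modulus of a complex difference be replaced by the square of one real kernel.\<close>

lemma integral_even_odd_sq:
  fixes a b u :: "'a::euclidean_space \<Rightarrow> real"
  assumes [measurable]: "a \<in> borel_measurable borel" "b \<in> borel_measurable borel"
    and u: "integrable lborel u"
    and sym: "\<And>s. a (- s) = a s" "\<And>s. b (- s) = - b s" "\<And>s. u (- s) = u s"
    and bound: "\<And>s. \<bar>a s\<bar> \<le> A" "\<And>s. \<bar>b s\<bar> \<le> B"
  shows "(\<integral>s. ((a s)\<^sup>2 + (b s)\<^sup>2) * u s \<partial>lborel) = (\<integral>s. (a s + b s)\<^sup>2 * u s \<partial>lborel)"
proof -
  have [measurable]: "u \<in> borel_measurable borel"
    using u by auto
  \<comment> \<open>A bounded factor keeps the product dominated by a multiple of \<open>u\<close>;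
    this covers the squares as well as the cross term.\<close>
  have int: "integrable lborel (\<lambda>s. \<phi> s * u s)"
    if [measurable]: "\<phi> \<in> borel_measurable borel" and \<phi>: "\<And>s. \<bar>\<phi> s\<bar> \<le> E"
    for \<phi> :: "'a \<Rightarrow> real" and E
    using u
    by (rule Bochner_Integration.integrable_bound[where f = "\<lambda>s. E * u s", OF integrable_mult_right])
       (auto simp: abs_mult intro!: AE_I2 mult_right_mono order_trans[OF \<phi>])
  have 1: "integrable lborel (\<lambda>s. ((a s)\<^sup>2 + (b s)\<^sup>2) * u s)"
    by (intro int[where E = "A\<^sup>2 + B\<^sup>2"] order_trans[OF abs_triangle_ineq] add_mono abs_power2_le bound) measurable
  have 2: "integrable lborel (\<lambda>s. (a s * b s) * u s)"
    by (intro int[where E = "A * B"] abs_mult_le bound) measurable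
  have "(\<integral>s. (a s * b s) * u s \<partial>lborel) = 0"
    using integral_lborel_uminus[of "\<lambda>s. (a s * b s) * u s"] by (simp add: sym)
  moreover have "(a s + b s)\<^sup>2 * u s = ((a s)\<^sup>2 + (b s)\<^sup>2) * u s + 2 * ((a s * b s) * u s)" for s
    by (simp add: power2_sum algebra_simps)
  ultimately show ?thesis
    using 1 2 by simp
qed

section \<open>Trigonometric kernels: parity, bounds and measurability\<close>

definition dcos :: "real ^ ('d::finite + 'd) \<Rightarrow> real ^ ('d + 'd) \<Rightarrow> real \<Rightarrow> real" where
  "dcos x s \<theta> = cos (s \<bullet> x) - cos (s \<bullet> (rot_matrix \<theta> *v x))"

definition dsin :: "real ^ ('d::finite + 'd) \<Rightarrow> real ^ ('d + 'd) \<Rightarrow> real \<Rightarrow> real" where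
  "dsin x s \<theta> = sin (s \<bullet> x) - sin (s \<bullet> (rot_matrix \<theta> *v x))"

text \<open>The splitting of \<open>ell\<close> into its even and odd parts in s; the same two
  functions are the real and imaginary parts in \<open>iexp_diff_eq_dcos_dsin\<close>.\<close>

lemma ell_eq_dcos_dsin: "ell x s \<theta> = dcos x s \<theta> + dsin x s \<theta>"
  by (simp add: ell_def CS_plus_def dcos_def dsin_def)

lemma dcos_uminus: "dcos x (- s) \<theta> = dcos x s \<theta>"
  and dsin_uminus: "dsin x (- s) \<theta> = - dsin x s \<theta>"
  by (simp_all add: dcos_def dsin_def)

lemma dcos_bound: "\<bar>dcos x s \<theta>\<bar> \<le> 2"
  unfolding dcos_def using abs_cos_le_one[of "s \<bullet> x"] abs_cos_le_one[of "s \<bullet> (rot_matrix \<theta> *v x)"] by linarith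

lemma dsin_bound: "\<bar>dsin x s \<theta>\<bar> \<le> 2"
  unfolding dsin_def using abs_sin_le_one[of "s \<bullet> x"] abs_sin_le_one[of "s \<bullet> (rot_matrix \<theta> *v x)"] by linarith

lemma ell_bound: "\<bar>ell x s \<theta>\<bar> \<le> 4"
  unfolding ell_eq_dcos_dsin using dcos_bound[of x s \<theta>] dsin_bound[of x s \<theta>] by linarith

lemma continuous_on_if_const:
  "continuous_on S f \<Longrightarrow> continuous_on S g \<Longrightarrow> continuous_on S (\<lambda>x. if b then f x else g x)"
  by (cases b) simp_all

text \<open>Each matrix entry is 0 or, up to sign, a sine or cosine of the angle. Joint continuity
  in x and \<open>\<theta>\<close> is what later gives the joint measurability required by
  Fubini.\<close>

lemma continuous_rot_matrix:
  "continuous_on UNIV (\<lambda>(x, \<theta>). rot_matrix \<theta> *v (x :: real ^ ('d::finite + 'd)))"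
proof -
  have "continuous_on UNIV (\<lambda>p :: (real ^ ('d + 'd)) \<times> real. rot_matrix (snd p) $ i $ j)" for i j :: "'d + 'd"
    by (cases i; cases j)
       (auto simp: rot_matrix_def simp del: if_cancel intro!: continuous_on_if_const continuous_intros)
  then show ?thesis
    unfolding matrix_vector_mult_def case_prod_unfold
    by (intro continuous_on_vec_lambda continuous_on_sum continuous_on_mult) (auto intro!: continuous_intros)
qed

lemma continuous_inner_rot_matrix:
  "continuous_on UNIV (\<lambda>(x :: real ^ ('d::finite + 'd), \<theta>, s). s \<bullet> (rot_matrix \<theta> *v x))"
proof -
  have "continuous_on UNIV (\<lambda>p. (\<lambda>(x, \<theta>). rot_matrix \<theta> *v (x :: real ^ ('d + 'd))) (fst p, fst (snd p)))"
    by (rule continuous_on_compose2[OF continuous_rot_matrix]) (auto intro!: continuous_intros)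
  then show ?thesis
    by (auto simp: case_prod_unfold intro!: continuous_intros)
qed

text \<open>The parameter p is the pair of angle and frequency, in the order of the product of
  \<open>Theta\<close> with the frequency space; hence the swapped projections.\<close>

lemma dcos_measurable:
  "(\<lambda>(x, p). dcos x (snd p) (fst p)) \<in> borel_measurable (borel :: ((real ^ ('d::finite + 'd)) \<times> real \<times> (real ^ ('d + 'd))) measure)"
  and dsin_measurable:
  "(\<lambda>(x, p). dsin x (snd p) (fst p)) \<in> borel_measurable (borel :: ((real ^ ('d::finite + 'd)) \<times> real \<times> (real ^ ('d + 'd))) measure)"
  using continuous_inner_rot_matrix[where 'd = 'd]
  by (auto simp: dcos_def dsin_def case_prod_unfold
      intro!: borel_measurable_continuous_onI continuous_intros)

lemma RI_measurable: "(RI :: complex ^ 'd::finite \<Rightarrow> _) \<in> borel_measurable borel"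
proof (rule borel_measurable_continuous_onI)
  have "continuous_on UNIV (\<lambda>z :: complex ^ 'd. case i of Inl k \<Rightarrow> Re (z $ k) | Inr k \<Rightarrow> Im (z $ k))"
    for i :: "'d + 'd"
    by (cases i) (auto intro!: continuous_intros)
  then show "continuous_on UNIV (RI :: complex ^ 'd \<Rightarrow> _)"
    unfolding RI_def by (rule continuous_on_vec_lambda)
qed

section \<open>Squared moduli of differences of characteristic functions\<close>

lemma iexp_diff_eq_dcos_dsin:
  "iexp (s \<bullet> RI z) - iexp (s \<bullet> RI (rotate \<theta> z)) = Complex (dcos (RI z) s \<theta>) (dsin (RI z) s \<theta>)"
  by (simp add: RI_rotate dcos_def dsin_def complex_eq_iff Re_exp Im_exp)

lemma sum_Complex: "(\<Sum>i\<in>I. Complex (a i) (b i)) = Complex (\<Sum>i\<in>I. a i) (\<Sum>i\<in>I. b i)"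
  by (induction I rule: infinite_finite_induct) (simp_all add: complex_eq_iff)

text \<open>Squared modulus as the sum of the squared real and imaginary parts; the sample indices
  1..n are shifted by \<open>Suc\<close> to start at 0.\<close>

lemma cmod_sq_emp_char_fun_diff:
  "(cmod (emp_char_fun (\<lambda>j \<omega>. RI (Zs j \<omega>)) n \<omega> s - emp_char_fun (\<lambda>j \<omega>. RI (rotate \<theta> (Zs j \<omega>))) n \<omega> s))\<^sup>2
   = ((\<Sum>i<n. dcos (RI (Zs (Suc i) \<omega>)) s \<theta>) / n)\<^sup>2 + ((\<Sum>i<n. dsin (RI (Zs (Suc i) \<omega>)) s \<theta>) / n)\<^sup>2"
proof -
  have "emp_char_fun (\<lambda>j \<omega>. RI (Zs j \<omega>)) n \<omega> s - emp_char_fun (\<lambda>j \<omega>. RI (rotate \<theta> (Zs j \<omega>))) n \<omega> s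
    = (\<Sum>j=1..n. iexp (s \<bullet> RI (Zs j \<omega>)) - iexp (s \<bullet> RI (rotate \<theta> (Zs j \<omega>)))) / of_nat n"
    by (simp add: emp_char_fun_def sum_subtractf diff_divide_distrib)
  also have "\<dots> = Complex (\<Sum>j=1..n. dcos (RI (Zs j \<omega>)) s \<theta>) (\<Sum>j=1..n. dsin (RI (Zs j \<omega>)) s \<theta>) / of_nat n"
    by (simp only: iexp_diff_eq_dcos_dsin sum_Complex)
  also have "{1..n} = Suc ` {..<n}"
    by (simp add: lessThan_atLeast0 image_Suc_atLeastLessThan atLeastLessThanSuc_atLeastAtMost)
  finally show ?thesis
    by (simp add: cmod_power2 sum.reindex)
qed

text \<open>The exponentials are bounded, hence integrable, so real and imaginary parts can be taken
  inside the expectation.\<close>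

lemma (in prob_space) cmod_sq_char_fun_diff:
  fixes Z :: "'a \<Rightarrow> complex ^ 'd::finite"
  assumes [measurable]: "random_variable borel Z"
  shows "(cmod (char_fun M (\<lambda>\<omega>. RI (Z \<omega>)) s - char_fun M (\<lambda>\<omega>. RI (rotate \<theta> (Z \<omega>))) s))\<^sup>2
    = (expectation (\<lambda>\<omega>. dcos (RI (Z \<omega>)) s \<theta>))\<^sup>2 + (expectation (\<lambda>\<omega>. dsin (RI (Z \<omega>)) s \<theta>))\<^sup>2"
proof -
  have m: "(\<lambda>\<omega>. RI (Z \<omega>)) \<in> borel_measurable M"
    using RI_measurable by measurable
  have "(\<lambda>x. rot_matrix \<theta> *v x) \<in> borel_measurable (borel :: (real ^ ('d + 'd)) measure)"
    by (intro borel_measurable_continuous_onI linear_continuous_on) simp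
  then have "(\<lambda>\<omega>. RI (rotate \<theta> (Z \<omega>))) \<in> borel_measurable M"
    unfolding RI_rotate by (rule measurable_compose[OF m])
  with m have int: "integrable M (\<lambda>\<omega>. iexp (s \<bullet> RI (Z \<omega>)))" "integrable M (\<lambda>\<omega>. iexp (s \<bullet> RI (rotate \<theta> (Z \<omega>))))"
    by (auto intro!: integrable_iexp)
  let ?D = "\<lambda>\<omega>. Complex (dcos (RI (Z \<omega>)) s \<theta>) (dsin (RI (Z \<omega>)) s \<theta>)"
  have D: "integrable M ?D"
    "char_fun M (\<lambda>\<omega>. RI (Z \<omega>)) s - char_fun M (\<lambda>\<omega>. RI (rotate \<theta> (Z \<omega>))) s = (CLINT \<omega>|M. ?D \<omega>)"
    using Bochner_Integration.integrable_diff[OF int] Bochner_Integration.integral_diff[OF int]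
    by (simp_all add: iexp_diff_eq_dcos_dsin char_fun_def)
  show ?thesis
    using integral_Re[OF D(1)] integral_Im[OF D(1)] by (simp add: D(2) cmod_power2)
qed

section \<open>Integration against the weighted measure on angles and frequencies\<close>

lemma borel_measurable_comp_snd:
  fixes u :: "'b::topological_space \<Rightarrow> 'c::topological_space"
  assumes "u \<in> borel_measurable borel"
  shows "(\<lambda>p :: 'a::topological_space \<times> 'b. u (snd p)) \<in> borel_measurable borel"
  by (rule measurable_compose[OF borel_measurable_continuous_onI assms]) (intro continuous_intros)

text \<open>By Tonelli the total mass is the length of \<open>Theta\<close> times the integral of
  the weight. Encoding the measure as a density with an indicator turns its integrals into set
  integrals over \<open>Theta \<times> UNIV\<close>.\<close>

lemma finite_measure_weight:
  fixes u :: "'a::euclidean_space \<Rightarrow> real"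
  assumes "integrable lborel u"
  shows "finite_measure (density lborel (\<lambda>p. ennreal (indicat_real (Theta \<times> UNIV) p * u (snd p))))"
proof
  have [measurable]: "u \<in> borel_measurable borel" "Theta \<in> sets borel"
    using assms by (auto simp: Theta_def)
  have [measurable]: "Theta \<times> (UNIV :: 'a set) \<in> sets borel"
    by (simp add: borel_Times)
  note borel_measurable_comp_snd[of u, measurable]
  let ?I = "\<lambda>\<theta> s. ennreal (indicat_real Theta \<theta> * u s)"
  have "(\<integral>\<^sup>+p. ennreal (indicat_real (Theta \<times> UNIV) p * u (snd p)) \<partial>lborel) = (\<integral>\<^sup>+\<theta>. \<integral>\<^sup>+s. ?I \<theta> s \<partial>lborel \<partial>lborel)"
    unfolding lborel_prod[symmetric]
    using lborel.nn_integral_fst[of "\<lambda>p. ennreal (indicat_real (Theta \<times> UNIV) p * u (snd p))" lborel]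
    by (simp add: indicator_times)
  also have "\<dots> = (\<integral>\<^sup>+\<theta>. ennreal (indicat_real Theta \<theta>) * (\<integral>\<^sup>+s. u s \<partial>lborel) \<partial>lborel)"
    by (intro nn_integral_cong) (simp split: split_indicator)
  also have "\<dots> = emeasure lborel Theta * (\<integral>\<^sup>+s. u s \<partial>lborel)"
    by (simp add: nn_integral_multc ennreal_indicator)
  also have "\<dots> < \<infinity>"
    using assms by (auto simp: Theta_def ennreal_mult_less_top real_integrable_def top.not_eq_extremum)
  finally show "emeasure (density lborel (\<lambda>p. ennreal (indicat_real (Theta \<times> UNIV) p * u (snd p))))
      (space (density lborel (\<lambda>p. ennreal (indicat_real (Theta \<times> UNIV) p * u (snd p))))) \<noteq> \<infinity>"
    by (subst emeasure_density) simp_all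
qed

text \<open>This joint form matches the set integrals in \<open>sigma_sq\<close>.\<close>

lemma integral_weight:
  fixes u :: "'a::euclidean_space \<Rightarrow> real" and \<phi> :: "real \<times> 'a \<Rightarrow> real"
  assumes [measurable]: "u \<in> borel_measurable borel" "\<phi> \<in> borel_measurable borel"
    and "\<And>s. 0 \<le> u s"
  shows "(\<integral>p. \<phi> p \<partial>density lborel (\<lambda>p. ennreal (indicat_real (Theta \<times> UNIV) p * u (snd p))))
    = (LINT p:Theta \<times> UNIV|lborel. \<phi> p * u (snd p))"
proof -
  have [measurable]: "Theta \<in> sets borel" by (simp add: Theta_def)
  have [measurable]: "Theta \<times> (UNIV :: 'a set) \<in> sets borel"
    by (simp add: borel_Times)
  note borel_measurable_comp_snd[OF assms(1), measurable]
  show ?thesis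
    using assms(3) by (subst integral_density) (auto simp: set_lebesgue_integral_def mult_ac)
qed

text \<open>This iterated form matches \<open>test_stat\<close> and \<open>Delta\<close>;
  boundedness on a finite measure supplies the integrability for Fubini.\<close>

lemma integral_weight_iterated:
  fixes u :: "'a::euclidean_space \<Rightarrow> real" and \<phi> :: "real \<times> 'a \<Rightarrow> real"
  assumes u: "integrable lborel u" "\<And>s. 0 \<le> u s"
    and [measurable]: "\<phi> \<in> borel_measurable borel" and bound: "\<And>p. \<bar>\<phi> p\<bar> \<le> B"
  shows "(\<integral>p. \<phi> p \<partial>density lborel (\<lambda>p. ennreal (indicat_real (Theta \<times> UNIV) p * u (snd p))))
    = (LINT \<theta>:Theta|lborel. LINT s|lborel. \<phi> (\<theta>, s) * u s)"
proof -
  have [measurable]: "u \<in> borel_measurable borel" using u by auto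
  have [measurable]: "Theta \<in> sets borel" by (simp add: Theta_def)
  have [measurable]: "Theta \<times> (UNIV :: 'a set) \<in> sets borel"
    by (simp add: borel_Times)
  note borel_measurable_comp_snd[of u, measurable]
  let ?\<nu> = "density lborel (\<lambda>p. ennreal (indicat_real (Theta \<times> UNIV) p * u (snd p)))"
  let ?F = "\<lambda>p. indicat_real (Theta \<times> UNIV) p * u (snd p) * \<phi> p"
  interpret finite_measure ?\<nu>
    using u(1) by (rule finite_measure_weight)
  have "integrable ?\<nu> \<phi>"
    using bound by (intro integrable_bounded) auto
  then have "integrable lborel ?F"
    using u(2) by (subst (asm) integrable_density) auto
  then have int: "integrable (lborel \<Otimes>\<^sub>M lborel) ?F"
    by (simp add: lborel_prod)
  have "integral\<^sup>L ?\<nu> \<phi> = integral\<^sup>L lborel ?F"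
    using u(2) by (subst integral_density) auto
  also have "\<dots> = (\<integral>\<theta>. \<integral>s. ?F (\<theta>, s) \<partial>lborel \<partial>lborel)"
    using lborel_pair.integral_fst'[OF int] by (simp add: lborel_prod)
  also have "\<dots> = (LINT \<theta>:Theta|lborel. LINT s|lborel. \<phi> (\<theta>, s) * u s)"
    unfolding set_lebesgue_integral_def
    by (intro Bochner_Integration.integral_cong refl) (simp add: indicator_times mult_ac split: split_indicator)
  finally show ?thesis .
qed

section \<open>Specialisation to the rotation kernel and the empirical characteristic
  functions\<close>

theorem theorem4p5:
  fixes M :: "'a measure"
    and Z :: "'a \<Rightarrow> complex ^ 'd" and Zs :: "nat \<Rightarrow> 'a \<Rightarrow> complex ^ 'd"
    and w :: "real \<Rightarrow> real"
  assumes "prob_space M"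
    and "iid M (Zs(0 := Z)) UNIV"
    and "w \<in> borel_measurable (restrict_space borel {0..})"
    and "\<And>r. r \<ge> 0 \<Longrightarrow> w r > 0"
    and "integrable lborel (\<lambda>s :: real ^ ('d::finite + 'd). w (norm s))"
    and "\<not> circularly_symmetric M Z"
  shows "0 \<le> sigma_sq w M Z \<and>
    weak_conv_m
      (\<lambda>n. distr M borel (\<lambda>\<omega>. sqrt (real n) * (test_stat w Zs n \<omega> / real n - Delta w M Z)))
      (centred_normal (sigma_sq w M Z))"
proof -
  interpret prob_space M by fact
  define u where "u s = w (norm s)" for s :: "real ^ ('d + 'd)"
  have u: "integrable lborel u" "\<And>s. 0 \<le> u s" "\<And>s. u (- s) = u s"
    using assms(4,5) by (auto simp: u_def[abs_def] less_imp_le)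
  then have u_meas [measurable]: "u \<in> borel_measurable borel" by auto
  define \<nu> where "\<nu> = density lborel (\<lambda>p :: real \<times> (real ^ ('d + 'd)). ennreal (indicat_real (Theta \<times> UNIV) p * u (snd p)))"
  define D where "D = distr M borel (\<lambda>\<omega>. RI (Z \<omega>))"
  \<comment> \<open>Index 0 of the family \<open>Zs(0 := Z)\<close> is occupied by Z itself, so the
    sample starts at \<open>Suc 0\<close>.\<close>
  define X where "X i \<omega> = RI (Zs (Suc i) \<omega>)" for i \<omega>
  define f where "f x p = ell x (snd p) (fst p)" for x :: "real ^ ('d + 'd)" and p
  have sets [measurable_cong, simp]: "sets D = sets borel" "sets \<nu> = sets borel"
    by (simp_all add: D_def \<nu>_def)
  have space [simp]: "space D = UNIV" "space \<nu> = UNIV"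
    by (simp_all add: D_def \<nu>_def)
  note RI_measurable [measurable]
  have dcos_m: "(\<lambda>(x :: (real ^ ('d + 'd)), p). dcos x (snd p) (fst p)) \<in> borel_measurable (borel \<Otimes>\<^sub>M borel)"
    and dsin_m: "(\<lambda>(x :: (real ^ ('d + 'd)), p). dsin x (snd p) (fst p)) \<in> borel_measurable (borel \<Otimes>\<^sub>M borel)"
    using dcos_measurable dsin_measurable by (simp_all add: borel_prod)
  \<comment> \<open>Joint measurability in composed form, so that sections and expectations of the
    kernels are handled automatically.\<close>
  have dcos_meas [measurable]: "(\<lambda>p. dcos (a p) (b p) (c p)) \<in> borel_measurable N"
    and dsin_meas [measurable]: "(\<lambda>p. dsin (a p) (b p) (c p)) \<in> borel_measurable N"
    if [measurable]: "a \<in> borel_measurable N" "b \<in> borel_measurable N" "c \<in> borel_measurable N"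
    for a b :: "'z \<Rightarrow> (real ^ ('d + 'd))" and c and N :: "'z measure"
  proof -
    have *: "(\<lambda>p. (a p, c p, b p)) \<in> N \<rightarrow>\<^sub>M borel \<Otimes>\<^sub>M borel"
      unfolding borel_prod[symmetric] by measurable
    show "(\<lambda>p. dcos (a p) (b p) (c p)) \<in> borel_measurable N" "(\<lambda>p. dsin (a p) (b p) (c p)) \<in> borel_measurable N"
      using measurable_compose[OF * dcos_m] measurable_compose[OF * dsin_m] by simp_all
  qed
  have Z_meas [measurable]: "Z \<in> borel_measurable M"
    and Zs_meas [measurable]: "\<And>i. Zs (Suc i) \<in> borel_measurable M"
    and distr_Zs: "\<And>i. distr M borel (Zs (Suc i)) = distr M borel Z"
  proof -
    have rv: "(Zs(0 := Z)) i \<in> borel_measurable M" for i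
      using assms(2) by (auto simp: iid_def indep_vars_def simp del: fun_upd_apply)
    show "Z \<in> borel_measurable M" "\<And>i. Zs (Suc i) \<in> borel_measurable M"
      using rv[of 0] rv[of "Suc _"] by simp_all
    have "distr M borel ((Zs(0 := Z)) i) = distr M borel ((Zs(0 := Z)) 0)" for i
      using assms(2) unfolding iid_def by blast
    from this[of "Suc _"] show "\<And>i. distr M borel (Zs (Suc i)) = distr M borel Z"
      by simp
  qed
  have f_pair: "(\<lambda>p. f (a p) (b p)) \<in> borel_measurable N"
    if [measurable]: "a \<in> borel_measurable N" "b \<in> borel_measurable N"
    for a and b :: "'z \<Rightarrow> real \<times> (real ^ ('d + 'd))" and N :: "'z measure"
  proof -
    have [measurable]: "(\<lambda>p. fst (b p)) \<in> borel_measurable N" "(\<lambda>p. snd (b p)) \<in> borel_measurable N"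
      using that(2) by (simp_all add: borel_prod[symmetric])
    show ?thesis
      unfolding f_def ell_eq_dcos_dsin by measurable
  qed
  interpret B: bounded_kernel M D \<nu> X f 4
  proof (intro bounded_kernel.intro bounded_kernel_axioms.intro prob_space_axioms)
    show "prob_space D"
      unfolding D_def by (rule prob_space_distr) measurable
    show "finite_measure \<nu>"
      unfolding \<nu>_def by (rule finite_measure_weight[OF u(1)])
    have "indep_vars (\<lambda>_. borel) (\<lambda>i. (Zs(0 := Z)) (Suc i)) UNIV"
      using indep_vars_reindex_inj[OF assms(2)[unfolded iid_def, THEN conjunct1] inj_Suc] .
    then have "indep_vars (\<lambda>_. borel) (\<lambda>i. Zs (Suc i)) UNIV"
      by simp
    then show "indep_vars (\<lambda>_. D) X UNIV"
      unfolding X_def[abs_def] by (rule indep_vars_compose2[where Y = "\<lambda>_. RI"]) measurable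
    show "distr M D (X i) = D" for i
    proof -
      have "distr M D (X i) = distr M borel (\<lambda>\<omega>. RI (Zs (Suc i) \<omega>))"
        unfolding X_def by (rule distr_cong) auto
      also have "\<dots> = distr (distr M borel (Zs (Suc i))) borel RI"
        by (simp add: distr_distr o_def)
      also have "\<dots> = D"
        by (simp add: distr_Zs distr_distr o_def D_def)
      finally show ?thesis .
    qed
    show "case_prod f \<in> borel_measurable (D \<Otimes>\<^sub>M \<nu>)"
      unfolding case_prod_unfold by (intro f_pair) measurable
    show "\<bar>f x q\<bar> \<le> 4" for x q
      unfolding f_def by (rule ell_bound)
  qed
  have v_eq: "B.v p = v_fun M Z (snd p) (fst p)" for p
  proof -
    have "(\<lambda>x. f x p) \<in> borel_measurable borel"
      by (intro f_pair) auto
    then have "(\<integral>x. f x p \<partial>D) = expectation (\<lambda>\<omega>. f (RI (Z \<omega>)) p)"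
      unfolding D_def by (subst integral_distr) auto
    then show ?thesis
      by (simp add: B.v_def v_fun_def f_def)
  qed
  have K_eq: "B.K p q = K_tilde M Z (snd p) (fst p) (snd q) (fst q)" for p q
  proof -
    have "(\<lambda>x. f x p * f x q) \<in> borel_measurable borel"
      by (intro f_pair borel_measurable_times) auto
    then have "(\<integral>x. f x p * f x q \<partial>D) = expectation (\<lambda>\<omega>. f (RI (Z \<omega>)) p * f (RI (Z \<omega>)) q)"
      unfolding D_def by (subst integral_distr) auto
    then show ?thesis
      by (simp add: B.K_def K_tilde_def v_eq f_def)
  qed
  have K_meas: "case_prod B.K \<in> borel_measurable (\<nu> \<Otimes>\<^sub>M \<nu>)"
    unfolding B.K_def by measurable
  have v_meas: "B.v \<in> borel_measurable borel"
    using B.v_measurable by (simp cong: measurable_cong_sets)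
  \<comment> \<open>The weight is introduced first for the outer variable q and then for the inner
    p, in the nesting of \<open>sigma_sq\<close>.\<close>
  have sigma: "sigma_sq w M Z = 4 * (\<integral>q. \<integral>p. B.K p q * B.v p * B.v q \<partial>\<nu> \<partial>\<nu>)"
  proof -
    have 1: "(\<lambda>q. \<integral>p. B.K p q * B.v p * B.v q \<partial>\<nu>) \<in> borel_measurable borel"
    proof -
      have "(\<lambda>q. \<integral>p. B.K p q * B.v p * B.v q \<partial>\<nu>) \<in> borel_measurable \<nu>"
        using K_meas by measurable
      then show ?thesis by (simp cong: measurable_cong_sets)
    qed
    have 2: "(\<lambda>p. B.K p q * B.v p * B.v q) \<in> borel_measurable borel" for q
    proof -
      have "(\<lambda>p. B.K p q * B.v p * B.v q) \<in> borel_measurable \<nu>"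
        using K_meas by measurable
      then show ?thesis by (simp cong: measurable_cong_sets)
    qed
    have "(\<integral>q. \<integral>p. B.K p q * B.v p * B.v q \<partial>\<nu> \<partial>\<nu>)
        = (LINT q:Theta \<times> UNIV|lborel. (\<integral>p. B.K p q * B.v p * B.v q \<partial>\<nu>) * u (snd q))"
      using integral_weight[OF u_meas 1 u(2)] unfolding \<nu>_def[symmetric] .
    also have "\<dots> = (LINT q:Theta \<times> UNIV|lborel. (LINT p:Theta \<times> UNIV|lborel. B.K p q * B.v p * B.v q * u (snd p)) * u (snd q))"
      using integral_weight[OF u_meas 2 u(2)] unfolding \<nu>_def[symmetric] by simp
    also have "\<dots> = (LINT q:Theta \<times> UNIV|lborel. (LINT p:Theta \<times> UNIV|lborel. B.K p q * B.v p * B.v q * u (snd p) * u (snd q)))"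
      by simp
    finally show ?thesis
      by (simp add: sigma_sq_def K_eq v_eq u_def case_prod_unfold)
  qed
  \<comment> \<open>Common reduction for the statistic and its limit: \<open>a\<close> is the even
    part, \<open>b\<close> the odd part, and the two bounds 2 add up to the bound 4 on
    \<open>\<phi>\<close>.\<close>
  have iter: "(LINT \<theta>:Theta|lborel. LINT s|lborel. ((a \<theta> s)\<^sup>2 + (b \<theta> s)\<^sup>2) * w (norm s)) = (\<integral>p. (\<phi> p)\<^sup>2 \<partial>\<nu>)"
    if a: "\<And>\<theta>. a \<theta> \<in> borel_measurable borel" "\<And>\<theta> s. \<bar>a \<theta> s\<bar> \<le> 2" "\<And>\<theta> s. a \<theta> (- s) = a \<theta> s"
      and b: "\<And>\<theta>. b \<theta> \<in> borel_measurable borel" "\<And>\<theta> s. \<bar>b \<theta> s\<bar> \<le> 2" "\<And>\<theta> s. b \<theta> (- s) = - b \<theta> s"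
      and \<phi>: "\<phi> \<in> borel_measurable borel" "\<And>\<theta> s. \<phi> (\<theta>, s) = a \<theta> s + b \<theta> s"
    for a b :: "real \<Rightarrow> (real ^ ('d + 'd)) \<Rightarrow> real" and \<phi>
  proof -
    have bound: "\<bar>(\<phi> p)\<^sup>2\<bar> \<le> 4\<^sup>2" for p
    proof (rule abs_power2_le)
      show "\<bar>\<phi> p\<bar> \<le> 4"
        using a(2)[of "fst p" "snd p"] b(2)[of "fst p" "snd p"] \<phi>(2)[of "fst p" "snd p"] by simp
    qed
    have "(\<integral>p. (\<phi> p)\<^sup>2 \<partial>\<nu>) = (LINT \<theta>:Theta|lborel. LINT s|lborel. (\<phi> (\<theta>, s))\<^sup>2 * u s)"
      unfolding \<nu>_def using \<phi>(1) by (intro integral_weight_iterated[OF u(1,2) _ bound]) simp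
    also have "\<dots> = (LINT \<theta>:Theta|lborel. LINT s|lborel. ((a \<theta> s)\<^sup>2 + (b \<theta> s)\<^sup>2) * u s)"
      using integral_even_odd_sq[OF a(1) b(1) u(1) a(3) b(3) u(3) a(2) b(2)] by (simp add: \<phi>(2))
    finally show ?thesis by (simp add: u_def)
  qed
  \<comment> \<open>Expectation preserves parity and bounds in s, so the means of
    \<open>dcos\<close> and \<open>dsin\<close> are admissible even and odd parts.\<close>
  have Delta: "Delta w M Z = (\<integral>p. (B.v p)\<^sup>2 \<partial>\<nu>)"
    unfolding Delta_def cmod_sq_char_fun_diff[OF Z_meas]
  proof (rule iter)
    fix \<theta> :: real and s :: "real ^ ('d + 'd)"
    show "(\<lambda>s. expectation (\<lambda>\<omega>. dcos (RI (Z \<omega>)) s \<theta>)) \<in> borel_measurable borel"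
      "(\<lambda>s. expectation (\<lambda>\<omega>. dsin (RI (Z \<omega>)) s \<theta>)) \<in> borel_measurable borel"
      by measurable
    show "\<bar>expectation (\<lambda>\<omega>. dcos (RI (Z \<omega>)) s \<theta>)\<bar> \<le> 2"
      "\<bar>expectation (\<lambda>\<omega>. dsin (RI (Z \<omega>)) s \<theta>)\<bar> \<le> 2"
      using abs_integral_le_bound[OF dcos_bound] abs_integral_le_bound[OF dsin_bound]
      by (simp_all add: prob_space)
    show "B.v (\<theta>, s) = expectation (\<lambda>\<omega>. dcos (RI (Z \<omega>)) s \<theta>) + expectation (\<lambda>\<omega>. dsin (RI (Z \<omega>)) s \<theta>)"
      unfolding v_eq v_fun_def ell_eq_dcos_dsin fst_conv snd_conv
      by (intro Bochner_Integration.integral_add integrable_bounded[OF _ dcos_bound]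
          integrable_bounded[OF _ dsin_bound]) measurable
  qed (simp_all add: dcos_uminus dsin_uminus v_meas)
  \<comment> \<open>A nonzero n is what lets the division cancel the factor n in
    \<open>test_stat\<close>.\<close>
  have stat: "test_stat w Zs n \<omega> / n = (\<integral>p. ((\<Sum>i<n. f (X i \<omega>) p) / n)\<^sup>2 \<partial>\<nu>)" if "n \<noteq> 0" for n \<omega>
  proof -
    have mean_bound: "\<bar>(\<Sum>i<n. a i) / real n\<bar> \<le> 2" if "\<And>i. \<bar>a i\<bar> \<le> 2" for a :: "nat \<Rightarrow> real"
      using order_trans[OF sum_abs sum_mono[of "{..<n}" "\<lambda>i. \<bar>a i\<bar>" "\<lambda>_. 2"]] that \<open>n \<noteq> 0\<close>
      by (simp add: field_simps)
    have "test_stat w Zs n \<omega> / n = (LINT \<theta>:Theta|lborel. LINT s|lborel.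
        (((\<Sum>i<n. dcos (RI (Zs (Suc i) \<omega>)) s \<theta>) / n)\<^sup>2 + ((\<Sum>i<n. dsin (RI (Zs (Suc i) \<omega>)) s \<theta>) / n)\<^sup>2) * w (norm s))"
      using \<open>n \<noteq> 0\<close> by (simp add: test_stat_def cmod_sq_emp_char_fun_diff)
    also have "\<dots> = (\<integral>p. ((\<Sum>i<n. f (X i \<omega>) p) / n)\<^sup>2 \<partial>\<nu>)"
    proof (rule iter)
      show "(\<lambda>p. (\<Sum>i<n. f (X i \<omega>) p) / n) \<in> borel_measurable borel"
        by (intro borel_measurable_divide borel_measurable_sum f_pair) auto
      show "\<And>\<theta>. (\<lambda>s. (\<Sum>i<n. dcos (RI (Zs (Suc i) \<omega>)) s \<theta>) / n) \<in> borel_measurable borel"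
        "\<And>\<theta>. (\<lambda>s. (\<Sum>i<n. dsin (RI (Zs (Suc i) \<omega>)) s \<theta>) / n) \<in> borel_measurable borel"
        by measurable
    qed (simp_all add: mean_bound dcos_bound dsin_bound dcos_uminus dsin_uminus sum_negf f_def X_def
        ell_eq_dcos_dsin sum.distrib add_divide_distrib del: abs_divide)
    finally show ?thesis .
  qed
  \<comment> \<open>At n = 0 the factor \<open>sqrt n\<close> makes both sides 0, so the identity
    holds along the whole sequence.\<close>
  have "sqrt n * (test_stat w Zs n \<omega> / n - Delta w M Z)
      = sqrt n * ((\<integral>p. ((\<Sum>i<n. f (X i \<omega>) p) / n)\<^sup>2 \<partial>\<nu>) - (\<integral>p. (B.v p)\<^sup>2 \<partial>\<nu>))" for n \<omega>
    by (cases "n = 0") (simp_all add: stat Delta)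
  then show ?thesis
    using B.weak_conv_sq_norm_mean B.variance_nonneg by (simp only: sigma)
qed

end
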